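(* There exist positive constants $c_1,c_2$ such that for all positive integers $n$ and $S$ for which $M(n,S)$ is nonempty, $$c_1\le\frac{\max M(n,S)}{\max M_4(n,S)}\le c_2,$$ i.e. $\max M(n,S)\asymp\max M_4(n,S)$ with implied constants independent of $n$ and $S$.
   Context: The continuant $\langle a_1,\ldots,a_n\rangle$ is defined by $\langle\,\rangle=1$, $\langle a_1\rangle=a_1$, $\langle a_1,\ldots,a_n\rangle=a_n\langle a_1,\ldots,a_{n-1}\rangle+\langle a_1,\ldots,a_{n-2}\rangle$. For a sequence $A=(a_1,\ldots,a_n)$ of positive integers let $S^{\varphi}_n(A)=\sum_{i=1}^n a_i(\frac32+\frac12(-1)^i)=a_1+2a_2+a_3+2a_4+\cdots$. $M(n,S)$ is the set of sequences of positive integers of length $n$ with $S^{\varphi}_n(A)=S$, and $\max M(n,S)$ denotes the maximum of $\langle A\rangle$ over $A\in M(n,S)$. $M_4(n,S)\subseteq M(n,S)$ is the set of those $A$ for which there exist positive integers $a,b$ with $a_i\in\{a,a+1\}$ for all odd $i$ and $a_i\in\{b,b+1\}$ for all even $i$; $\max M_4(n,S)$ is the maximum of $\langle A\rangle$ over this set. *)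

theory Defs
  imports Complex_Main
begin

(* Continuant computed from the last element backwards:
   crev [a_n, ..., a_1] = <a_1,...,a_n>, using
   <a_1..a_n> = a_n <a_1..a_{n-1}> + <a_1..a_{n-2}>. *)
fun crev :: "nat list \<Rightarrow> nat" where
  "crev [] = 1"
| "crev [a] = a"
| "crev (a # b # rest) = a * crev (b # rest) + crev rest"

definition continuant :: "nat list \<Rightarrow> nat" where
  "continuant A = crev (rev A)"

(* S^phi(A) = sum_{i=1}^n a_i (3/2 + (-1)^i/2); list index k corresponds to i = k+1 *)
definition Sphi :: "nat list \<Rightarrow> nat" where
  "Sphi A = (\<Sum>k<length A. A ! k * (if even (k + 1) then 2 else 1))"

definition M :: "nat \<Rightarrow> nat \<Rightarrow> nat list set" where
  "M n S = {A. length A = n \<and> (\<forall>x\<in>set A. 0 < x) \<and> Sphi A = S}"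

definition M4 :: "nat \<Rightarrow> nat \<Rightarrow> nat list set" where
  "M4 n S = {A \<in> M n S. \<exists>a b. 0 < a \<and> 0 < b \<and>
      (\<forall>k<length A. (even k \<longrightarrow> A ! k \<in> {a, a + 1}) \<and>
                      (odd k \<longrightarrow> A ! k \<in> {b, b + 1}))}"

definition maxM :: "nat \<Rightarrow> nat \<Rightarrow> nat" where
  "maxM n S = Max (continuant ` M n S)"

definition maxM4 :: "nat \<Rightarrow> nat \<Rightarrow> nat" where
  "maxM4 n S = Max (continuant ` M4 n S)"

end

theory Submission
  imports Defs
begin

text \<open>Let \<open>i, j\<close> be positions of equal parity with \<open>a\<^sub>i \<ge> a\<^sub>j + 2\<close>. Moving one unit from \<open>a\<^sub>i\<close> to \<open>a\<^sub>j\<close>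
  preserves the weighted sum, and up to a positive factor it changes the continuant by
  \<open>a\<^sub>i - a\<^sub>j - 1 + u - v\<close>, where \<open>u\<close> and \<open>v\<close> in \<open>[0, 2]\<close> are sums of two continued fractions read
  off to the left and to the right of \<open>i\<close> and of \<open>j\<close>. Moves that do not decrease the continuant lead
  to a sequence in which each parity class takes values in some \<open>{c, c + 1, c + 2}\<close> and every pair
  with values \<open>c + 2\<close> and \<open>c\<close> has \<open>v > 1 + u\<close>. This cannot happen with both positions away from the
  ends: it forces the neighbours of \<open>c\<close> to be \<open>1\<close> and hence the other class into \<open>{1, 2, 3}\<close>; if
  \<open>c + 2\<close> has a neighbour \<open>3\<close>, the same argument in the other class makes the ones spread over the
  whole interior, and otherwise
  \<open>v \<le> 2 / (1 + 1 / (c + 3)) \<le> 1 + 2 / (2 + 1 / c) \<le> 1 + u\<close>. So \<open>c\<close> or \<open>c + 2\<close> occurs a bounded number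
  of times, and boundedly many further moves, each losing at most a factor \<open>2\<close>, make both classes
  two-valued.\<close>

section \<open>Continuants as entries of matrix products\<close>

text \<open>The product of the matrices with rows \<open>(a, 1)\<close> and \<open>(1, 0)\<close> over the entries \<open>a\<close> of a list has
  rows \<open>(crev, cinit)\<close> and \<open>(ctail, cmid)\<close>; these are the continuants of the list with nothing, the
  last, the first, or both end entries removed.\<close>

fun ctail :: "nat list \<Rightarrow> nat" where
  "ctail [] = 0"
| "ctail (a # A) = crev A"

fun cinit :: "nat list \<Rightarrow> nat" where
  "cinit [] = 0"
| "cinit [a] = 1"
| "cinit (a # b # A) = a * cinit (b # A) + cinit A"

fun cmid :: "nat list \<Rightarrow> nat" where
  "cmid [] = 1"
| "cmid (a # A) = cinit A"

lemma crev_Cons: "crev (a # A) = a * crev A + ctail A"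
  by (cases A) auto

lemma cinit_Cons: "cinit (a # A) = a * cinit A + cmid A"
  by (cases A) auto

text \<open>First column of the product of the matrices of \<open>A\<close> and \<open>B\<close>.
  The values of the four functions at \<open>[]\<close> form the identity matrix.\<close>

lemma crev_ctail_append:
  "crev (A @ B) = crev A * crev B + cinit A * ctail B \<and>
   ctail (A @ B) = ctail A * crev B + cmid A * ctail B"
  by (induction A) (auto simp: crev_Cons cinit_Cons algebra_simps)

lemmas crev_append = crev_ctail_append[THEN conjunct1]
  and ctail_append = crev_ctail_append[THEN conjunct2]

text \<open>Right multiplication by the matrix of \<open>[a]\<close> moves the first column into the
  second.\<close>

lemma cinit_cmid_snoc: "cinit (A @ [a]) = crev A \<and> cmid (A @ [a]) = ctail A"
  by (induction A) (auto simp: crev_Cons cinit_Cons)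

text \<open>Every factor is symmetric, so reversing the list transposes the product.\<close>

lemma crev_cinit_rev: "crev (rev A) = crev A \<and> cinit (rev A) = ctail A"
  by (induction A) (auto simp: crev_append crev_Cons cinit_cmid_snoc)

lemma crev_rev: "crev (rev A) = crev A"
  and ctail_rev: "ctail (rev A) = cinit A"
  using crev_cinit_rev[of A] crev_cinit_rev[of "rev A"] by auto

lemma crev_pos: "\<forall>x\<in>set A. 0 < x \<Longrightarrow> 0 < crev A"
  by (induction A) (auto simp: crev_Cons)

section \<open>Continued fractions as quotients of continuants\<close>

text \<open>The value of the continued fraction \<open>[0; a\<^sub>1, a\<^sub>2, \<dots>]\<close>.\<close>

definition cfrac :: "nat list \<Rightarrow> real" where
  "cfrac A = real (ctail A) / real (crev A)"

lemma cfrac_Nil [simp]: "cfrac [] = 0"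
  by (simp add: cfrac_def)

lemma cfrac_Cons:
  assumes "\<forall>x\<in>set A. 0 < x"
  shows "cfrac (a # A) = 1 / (real a + cfrac A)"
proof -
  have "real (crev A) > 0" using crev_pos[OF assms] by simp
  then show ?thesis by (simp add: cfrac_def crev_Cons field_simps)
qed

lemma cfrac_nonneg: "0 \<le> cfrac A"
  by (simp add: cfrac_def)

lemma cfrac_le_inverse_hd:
  assumes "\<forall>x\<in>set A. 0 < x" "0 < a"
  shows "cfrac (a # A) \<le> 1 / real a"
  using assms cfrac_nonneg[of A] by (simp add: cfrac_Cons frac_le)

lemma cfrac_le_1: "\<forall>x\<in>set A. 0 < x \<Longrightarrow> cfrac A \<le> 1"
proof (cases A)
  case (Cons a B)
  assume "\<forall>x\<in>set A. 0 < x"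
  with Cons have "cfrac A \<le> 1 / real a" "0 < a" by (auto intro: cfrac_le_inverse_hd)
  moreover have "1 / real a \<le> 1" using \<open>0 < a\<close> by simp
  ultimately show ?thesis by linarith
qed simp

lemma cfrac_ge_inverse_Suc_hd:
  assumes "\<forall>x\<in>set A. 0 < x" "0 < a"
  shows "1 / (real a + 1) \<le> cfrac (a # A)"
  using assms cfrac_nonneg[of A] cfrac_le_1[of A] by (simp add: cfrac_Cons frac_le)

lemma cfrac_upper2:
  assumes "\<forall>x\<in>set A. 0 < x" "0 < a" "0 < b"
  shows "cfrac (a # b # A) \<le> 1 / (real a + 1 / (real b + 1))"
proof -
  have "1 / (real b + 1) \<le> cfrac (b # A)" "cfrac (a # b # A) = 1 / (real a + cfrac (b # A))"
    using assms cfrac_ge_inverse_Suc_hd[of A b] cfrac_Cons[of "b # A" a] by auto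
  then show ?thesis using assms by (simp add: frac_le add_pos_pos)
qed

lemma cfrac_lower2:
  assumes "\<forall>x\<in>set A. 0 < x" "0 < a" "cfrac A \<le> c"
  shows "1 / (real a + c) \<le> cfrac (a # A)"
  using assms cfrac_nonneg[of A] by (simp add: cfrac_Cons frac_le)

text \<open>Put \<open>p = cfrac (rev X) + cfrac Y\<close> and
  \<open>q = cfrac (rev Y) + cfrac Z\<close>. Divided by the continuants of the three segments, the
  continuant of \<open>X @ x # Y @ y # Z\<close> is \<open>(x + p) * (y + q)\<close> plus a term
  free of \<open>x\<close> and \<open>y\<close>.\<close>

lemma crev_transfer:
  assumes "\<forall>x\<in>set X. 0 < x" "\<forall>x\<in>set Y. 0 < x" "\<forall>x\<in>set Z. 0 < x"
  shows "real (crev (X @ a # Y @ Suc b # Z)) - real (crev (X @ Suc a # Y @ b # Z)) =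
    real (crev X) * real (crev Y) * real (crev Z) *
    (real a - real b + (cfrac (rev X) + cfrac Y) - (cfrac (rev Y) + cfrac Z))"
proof -
  have "real (crev X) > 0" "real (crev Y) > 0" "real (crev Z) > 0"
    using assms crev_pos by auto
  then show ?thesis
    by (simp add: cfrac_def crev_rev ctail_rev crev_append ctail_append crev_Cons field_simps)
qed

section \<open>Transferring one unit between two entries\<close>

text \<open>The two continued fractions read off from position \<open>i\<close> to the left and to the right, the
  one that runs towards position \<open>j\<close> being cut off before \<open>j\<close>.\<close>

definition lfrac :: "nat list \<Rightarrow> nat \<Rightarrow> nat \<Rightarrow> real" where
  "lfrac A i j = cfrac (rev (drop (if j < i then Suc j else 0) (take i A)))"

definition rfrac :: "nat list \<Rightarrow> nat \<Rightarrow> nat \<Rightarrow> real" where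
  "rfrac A i j = cfrac (drop (Suc i) (take (if i < j then j else length A) A))"

definition transfer :: "nat list \<Rightarrow> nat \<Rightarrow> nat \<Rightarrow> nat list" where
  "transfer A i j = A[i := A ! i - 1, j := Suc (A ! j)]"

lemma list_split_two:
  assumes "i < j" "j < length A"
  shows "A[i := x, j := y] = take i A @ x # drop (Suc i) (take j A) @ y # drop (Suc j) A"
proof -
  have "A[i := x, j := y] = (take j A @ y # drop (Suc j) A)[i := x]"
    using assms by (simp add: list_update_swap flip: upd_conv_take_nth_drop)
  also have "\<dots> = (take j A)[i := x] @ y # drop (Suc j) A"
    using assms by (simp add: list_update_append)
  also have "(take j A)[i := x] = take i A @ x # drop (Suc i) (take j A)"
    using assms by (simp add: upd_conv_take_nth_drop min_def)
  finally show ?thesis by simp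
qed

lemma crev_le_transfer:
  assumes pos: "\<forall>x\<in>set A. 0 < x" and ij: "i \<noteq> j" "i < length A" "j < length A"
    and bal: "lfrac A j i + rfrac A j i + 1 + real (A ! j) \<le>
      real (A ! i) + (lfrac A i j + rfrac A i j)"
  shows "crev A \<le> crev (transfer A i j)"
proof -
  have Ai: "A ! i = Suc (A ! i - 1)" using pos ij by (metis Suc_pred' nth_mem)
  show ?thesis
  proof (cases "i < j")
    case True
    let ?X = "take i A" and ?Y = "drop (Suc i) (take j A)" and ?Z = "drop (Suc j) A"
    have "\<forall>x\<in>set ?X. 0 < x" "\<forall>x\<in>set ?Y. 0 < x" "\<forall>x\<in>set ?Z. 0 < x"
      using pos by (meson in_set_takeD in_set_dropD)+
    note eq = crev_transfer[OF this, of "A ! i - 1" "A ! j"]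
    have "A = ?X @ Suc (A ! i - 1) # ?Y @ A ! j # ?Z"
      using list_split_two[OF True ij(3), of "A ! i" "A ! j"] Ai by simp
    moreover have "transfer A i j = ?X @ (A ! i - 1) # ?Y @ Suc (A ! j) # ?Z"
      using list_split_two[OF True ij(3)] by (simp add: transfer_def)
    moreover have "0 \<le> real (A ! i - 1) - real (A ! j) + (cfrac (rev ?X) + cfrac ?Y)
        - (cfrac (rev ?Y) + cfrac ?Z)"
      using bal True Ai by (simp add: lfrac_def rfrac_def)
    ultimately show ?thesis using eq
      by (smt (verit) mult_nonneg_nonneg of_nat_0_le_iff of_nat_le_iff)
  next
    case False
    then have ji: "j < i" using ij by simp
    let ?X = "take j A" and ?Y = "drop (Suc j) (take i A)" and ?Z = "drop (Suc i) A"
    have "\<forall>x\<in>set ?X. 0 < x" "\<forall>x\<in>set ?Y. 0 < x" "\<forall>x\<in>set ?Z. 0 < x"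
      using pos by (meson in_set_takeD in_set_dropD)+
    \<comment> \<open>The unit now moves leftwards, so \<open>A\<close> and its transfer exchange
      roles in the identity and the bracket has to be nonpositive.\<close>
    note eq = crev_transfer[OF this, of "A ! j" "A ! i - 1"]
    have "A = ?X @ A ! j # ?Y @ Suc (A ! i - 1) # ?Z"
      using list_split_two[OF ji ij(2), of "A ! j" "A ! i"] Ai by simp
    moreover have "transfer A i j = ?X @ Suc (A ! j) # ?Y @ (A ! i - 1) # ?Z"
      using list_split_two[OF ji ij(2)] ij by (simp add: transfer_def list_update_swap)
    moreover have "real (A ! j) - real (A ! i - 1) + (cfrac (rev ?X) + cfrac ?Y)
        - (cfrac (rev ?Y) + cfrac ?Z) \<le> 0"
      using bal ji Ai by (simp add: lfrac_def rfrac_def)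
    ultimately show ?thesis using eq
      by (smt (verit) mult_nonneg_nonpos mult_nonneg_nonneg of_nat_0_le_iff of_nat_le_iff)
  qed
qed

lemma crev_update:
  assumes "i < length A"
  obtains P Q where "\<And>x. crev (A[i := x]) = x * P + Q"
proof
  fix x
  show "crev (A[i := x]) = x * (crev (take i A) * crev (drop (Suc i) A)) +
      (crev (take i A) * ctail (drop (Suc i) A) + cinit (take i A) * crev (drop (Suc i) A))"
    using assms by (simp add: upd_conv_take_nth_drop crev_append crev_Cons algebra_simps)
qed

text \<open>The continuant is affine in each entry with nonnegative coefficients:
  \<open>x * P + Q\<close> at most halves when some \<open>x\<close> \<ge> 2 drops by one, and
  raising the other entry does not decrease it.\<close>

lemma crev_le_twice_transfer:
  assumes ij: "i \<noteq> j" "i < length A" "j < length A" and ge: "2 \<le> A ! i"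
  shows "crev A \<le> 2 * crev (transfer A i j)"
proof -
  obtain P Q where PQ: "\<And>x. crev (A[i := x]) = x * P + Q"
    using crev_update[OF ij(2)] by blast
  obtain k where k: "A ! i = Suc (Suc k)" using ge by (metis Suc_le_D numeral_2_eq_2 Suc_le_mono)
  have "crev A \<le> 2 * crev (A[i := A ! i - 1])"
    using PQ[of "A ! i"] PQ[of "A ! i - 1"] k list_update_id[of A i] by simp
  moreover have "crev (A[i := A ! i - 1]) \<le> crev (transfer A i j)"
  proof -
    have "j < length (A[i := A ! i - 1])" using ij by simp
    then obtain P' Q' where "\<And>x. crev (A[i := A ! i - 1, j := x]) = x * P' + Q'"
      using crev_update by blast
    moreover have "A[i := A ! i - 1, j := A ! j] = A[i := A ! i - 1]"
      using ij by (simp add: list_update_same_conv)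
    ultimately have "crev (A[i := A ! i - 1]) = A ! j * P' + Q'"
      "crev (transfer A i j) = Suc (A ! j) * P' + Q'"
      unfolding transfer_def by metis+
    then show ?thesis by simp
  qed
  ultimately show ?thesis by simp
qed

lemma length_transfer [simp]: "length (transfer A i j) = length A"
  by (simp add: transfer_def)

lemma nth_transfer:
  assumes "i \<noteq> j" "i < length A" "j < length A"
  shows "transfer A i j ! k = (if k = i then A ! i - 1 else if k = j then Suc (A ! j) else A ! k)"
  using assms by (auto simp: transfer_def nth_list_update)

lemma transfer_pos:
  assumes "\<forall>x\<in>set A. 0 < x" "i \<noteq> j" "i < length A" "j < length A" "2 \<le> A ! i"
  shows "\<forall>x\<in>set (transfer A i j). 0 < x"
  using assms by (auto simp: all_set_conv_all_nth nth_transfer)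

lemma sum_remove_two:
  fixes f :: "nat \<Rightarrow> nat"
  assumes "i \<noteq> j" "i < n" "j < n"
  shows "(\<Sum>k<n. f k) = f i + f j + (\<Sum>k\<in>{..<n} - {i, j}. f k)"
proof -
  have "(\<Sum>k<n. f k) = f i + (f j + (\<Sum>k\<in>{..<n} - {i} - {j}. f k))"
    using assms by (subst sum.remove[of _ i], simp_all, subst sum.remove[of _ j], simp_all)
  moreover have "{..<n} - {i} - {j} = {..<n} - {i, j}" by auto
  ultimately show ?thesis by simp
qed

lemma Sphi_transfer:
  assumes ij: "i \<noteq> j" "i < length A" "j < length A" and "even i = even j" "0 < A ! i"
  shows "Sphi (transfer A i j) = Sphi A"
proof -
  have "(\<Sum>k\<in>{..<length A} - {i, j}. transfer A i j ! k * (if even (k + 1) then 2 else 1)) =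
      (\<Sum>k\<in>{..<length A} - {i, j}. A ! k * (if even (k + 1) then 2 else 1))"
    using ij by (intro sum.cong) (auto simp: nth_transfer)
  moreover obtain m where "A ! i = Suc m" using assms by (metis Suc_pred')
  ultimately show ?thesis
    using assms sum_remove_two[OF ij] unfolding Sphi_def length_transfer
    by (simp add: nth_transfer)
qed

text \<open>Provides the descent measure for repeated transfers.\<close>

lemma sum_squares_transfer:
  assumes ij: "i \<noteq> j" "i < length A" "j < length A" and ge: "A ! j + 2 \<le> A ! i"
  shows "(\<Sum>k<length A. (transfer A i j ! k)\<^sup>2) < (\<Sum>k<length A. (A ! k)\<^sup>2)"
proof -
  have eq: "(\<Sum>k\<in>{..<length A} - {i, j}. (transfer A i j ! k)\<^sup>2) =
      (\<Sum>k\<in>{..<length A} - {i, j}. (A ! k)\<^sup>2)"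
    using ij by (intro sum.cong) (auto simp: nth_transfer)
  obtain d where d: "A ! i = A ! j + 2 + d" using ge le_Suc_ex by blast
  have "(transfer A i j ! i)\<^sup>2 + (transfer A i j ! j)\<^sup>2 < (A ! i)\<^sup>2 + (A ! j)\<^sup>2"
    using ij d by (simp add: nth_transfer power2_eq_square algebra_simps)
  with eq show ?thesis
    by (simp add: sum_remove_two[OF ij, of "\<lambda>k. (A ! k)\<^sup>2"]
        sum_remove_two[OF ij, of "\<lambda>k. (transfer A i j ! k)\<^sup>2"])
qed


section \<open>Bounds on the fractions read off at a position\<close>

lemma left_segment:
  assumes "l < i" "i \<le> length A"
  shows "rev (drop l (take i A)) = A ! (i - 1) # rev (drop l (take (i - 1) A))"
proof -
  obtain k where "i = Suc k" using assms by (cases i) auto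
  with assms show ?thesis by (simp add: take_Suc_conv_app_nth)
qed

lemma right_segment:
  assumes "i < m" "m \<le> length A"
  shows "drop i (take m A) = A ! i # drop (Suc i) (take m A)"
  using assms Cons_nth_drop_Suc[of i "take m A"] by simp

context
  fixes A :: "nat list"
  assumes pos: "\<forall>x\<in>set A. 0 < x"
begin

lemma nth_pos: "i < length A \<Longrightarrow> 0 < A ! i"
  using pos by simp

lemma segment_pos:
  "\<forall>x\<in>set (rev (drop l (take i A))). 0 < x" "\<forall>x\<in>set (drop l (take i A)). 0 < x"
  using pos by (auto dest!: in_set_takeD in_set_dropD)

lemma lfrac_bounds01: "0 \<le> lfrac A i j" "lfrac A i j \<le> 1"
  unfolding lfrac_def by (rule cfrac_nonneg, rule cfrac_le_1[OF segment_pos(1)])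

lemma rfrac_bounds01: "0 \<le> rfrac A i j" "rfrac A i j \<le> 1"
  unfolding rfrac_def by (rule cfrac_nonneg, rule cfrac_le_1[OF segment_pos(2)])

text \<open>Truncation after one or two entries. \<open>j \<noteq> i - 1\<close> keeps the nearest
  entry in the segment. If \<open>j = i - 2\<close>, the rest of the segment is empty and its
  fraction is 0, which still suits the third bound but not the fourth.\<close>

lemma lfrac_bounds:
  assumes i: "2 \<le> i" "i < length A" and j: "j \<noteq> i - 1"
  shows "lfrac A i j \<le> 1 / real (A ! (i - 1))"
    and "1 / (real (A ! (i - 1)) + 1) \<le> lfrac A i j"
    and "1 / (real (A ! (i - 1)) + 1 / real (A ! (i - 2))) \<le> lfrac A i j"
    and "j \<noteq> i - 2 \<Longrightarrow>
      lfrac A i j \<le> 1 / (real (A ! (i - 1)) + 1 / (real (A ! (i - 2)) + 1))"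
proof -
  define l where "l = (if j < i then Suc j else 0)"
  have l: "l < i" using i j by (auto simp: l_def)
  have p: "0 < A ! (i - 1)" "0 < A ! (i - 2)" using i by (auto intro!: nth_pos)
  have eq: "lfrac A i j = cfrac (A ! (i - 1) # rev (drop l (take (i - 1) A)))"
    using left_segment[of l i A] l i by (simp add: lfrac_def l_def)
  have eq2: "rev (drop l (take (i - 1) A)) = A ! (i - 2) # rev (drop l (take (i - 2) A))"
    if "l < i - 1"
    using left_segment[of l "i - 1" A] that i by (simp add: numeral_2_eq_2)
  show "lfrac A i j \<le> 1 / real (A ! (i - 1))"
    unfolding eq by (rule cfrac_le_inverse_hd[OF segment_pos(1) p(1)])
  show "1 / (real (A ! (i - 1)) + 1) \<le> lfrac A i j"
    unfolding eq by (rule cfrac_ge_inverse_Suc_hd[OF segment_pos(1) p(1)])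
  have "cfrac (rev (drop l (take (i - 1) A))) \<le> 1 / real (A ! (i - 2))"
  proof (cases "l < i - 1")
    case True
    show ?thesis unfolding eq2[OF True] by (rule cfrac_le_inverse_hd[OF segment_pos(1) p(2)])
  next
    case False
    then have "drop l (take (i - 1) A) = []" by simp
    then show ?thesis by simp
  qed
  then show "1 / (real (A ! (i - 1)) + 1 / real (A ! (i - 2))) \<le> lfrac A i j"
    unfolding eq by (rule cfrac_lower2[OF segment_pos(1) p(1)])
  assume "j \<noteq> i - 2"
  then have "l < i - 1" using i j by (auto simp: l_def)
  then show "lfrac A i j \<le> 1 / (real (A ! (i - 1)) + 1 / (real (A ! (i - 2)) + 1))"
    unfolding eq using eq2 cfrac_upper2[OF segment_pos(1) p] by simp
qed

lemma rfrac_bounds: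
  assumes i: "i + 2 < length A" and j: "j \<noteq> i + 1"
  shows "rfrac A i j \<le> 1 / real (A ! (i + 1))"
    and "1 / (real (A ! (i + 1)) + 1) \<le> rfrac A i j"
    and "1 / (real (A ! (i + 1)) + 1 / real (A ! (i + 2))) \<le> rfrac A i j"
    and "j \<noteq> i + 2 \<Longrightarrow> j < length A \<Longrightarrow>
      rfrac A i j \<le> 1 / (real (A ! (i + 1)) + 1 / (real (A ! (i + 2)) + 1))"
proof -
  \<comment> \<open>The outer \<open>min\<close> keeps the right end inside the list even if
    \<open>j\<close> lies beyond it.\<close>
  define m where "m = min (if i < j then j else length A) (length A)"
  have m: "i + 1 < m" "m \<le> length A" using i j by (auto simp: m_def)
  have p: "0 < A ! (i + 1)" "0 < A ! (i + 2)" using i by (auto intro!: nth_pos)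
  have "take m A = take (if i < j then j else length A) A"
    by (auto simp: m_def min_def)
  then have eq: "rfrac A i j = cfrac (A ! (i + 1) # drop (i + 2) (take m A))"
    using right_segment[of "i + 1" m A] m by (simp add: rfrac_def)
  have eq2: "drop (i + 2) (take m A) = A ! (i + 2) # drop (i + 3) (take m A)" if "i + 2 < m"
    using right_segment[of "i + 2" m A] that m by (simp add: numeral_3_eq_3)
  show "rfrac A i j \<le> 1 / real (A ! (i + 1))"
    unfolding eq by (rule cfrac_le_inverse_hd[OF segment_pos(2) p(1)])
  show "1 / (real (A ! (i + 1)) + 1) \<le> rfrac A i j"
    unfolding eq by (rule cfrac_ge_inverse_Suc_hd[OF segment_pos(2) p(1)])
  have "cfrac (drop (i + 2) (take m A)) \<le> 1 / real (A ! (i + 2))"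
  proof (cases "i + 2 < m")
    case True
    show ?thesis unfolding eq2[OF True] by (rule cfrac_le_inverse_hd[OF segment_pos(2) p(2)])
  next
    case False
    then have "drop (i + 2) (take m A) = []" by simp
    then show ?thesis by simp
  qed
  then show "1 / (real (A ! (i + 1)) + 1 / real (A ! (i + 2))) \<le> rfrac A i j"
    unfolding eq by (rule cfrac_lower2[OF segment_pos(2) p(1)])
  assume "j \<noteq> i + 2" "j < length A"
  then have "i + 2 < m" using i j by (auto simp: m_def)
  then show "rfrac A i j \<le> 1 / (real (A ! (i + 1)) + 1 / (real (A ! (i + 2)) + 1))"
    unfolding eq using eq2 cfrac_upper2[OF segment_pos(2) p] by simp
qed

text \<open>Both are the fraction of the single entry between the two positions.\<close>

lemma lfrac_rfrac_two_apart:
  assumes "i + 2 < length A"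
  shows "rfrac A i (i + 2) = lfrac A (i + 2) i"
  using assms left_segment[of "Suc i" "i + 2" A] right_segment[of "Suc i" "i + 2" A]
  by (simp add: lfrac_def rfrac_def)

end

section \<open>Sequences that no transfer improves\<close>

text \<open>The criterion of \<open>crev_le_transfer\<close> fails for every pair of equal parity
  with gap at least 2. A gap of 3 or more always meets it, since all four fractions lie in [0, 1];
  so only gap 2 survives.\<close>

definition balanced :: "nat list \<Rightarrow> bool" where
  "balanced A \<longleftrightarrow> (\<forall>i<length A. \<forall>j<length A. even i = even j \<longrightarrow> A ! j + 2 \<le> A ! i \<longrightarrow>
     A ! i = A ! j + 2 \<and> 1 + (lfrac A i j + rfrac A i j) < lfrac A j i + rfrac A j i)"

text \<open>Among the sequences with continuant at least \<open>crev B\<close>, one with least sum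
  of squares is balanced: otherwise a transfer would lower that sum.\<close>

lemma exists_balanced:
  assumes "B \<in> M n S"
  obtains A where "A \<in> M n S" "crev B \<le> crev A" "balanced A"
proof -
  define sq :: "nat list \<Rightarrow> nat" where "sq A = (\<Sum>k<length A. (A ! k)\<^sup>2)" for A
  obtain A where A: "A \<in> M n S" "crev B \<le> crev A"
    and least: "\<And>C. C \<in> M n S \<Longrightarrow> crev B \<le> crev C \<Longrightarrow> sq A \<le> sq C"
    using ex_has_least_nat[of "\<lambda>A. A \<in> M n S \<and> crev B \<le> crev A" B sq] assms by blast
  have pos: "\<forall>x\<in>set A. 0 < x" using A by (simp add: M_def)
  have "balanced A" unfolding balanced_def
  proof (intro allI impI, rule ccontr)
    fix i j
    assume ij: "i < length A" "j < length A" "even i = even j" and ge: "A ! j + 2 \<le> A ! i"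
      and neg: "\<not> (A ! i = A ! j + 2 \<and>
        1 + (lfrac A i j + rfrac A i j) < lfrac A j i + rfrac A j i)"
    have neq: "i \<noteq> j" using ge by auto
    have "lfrac A j i + rfrac A j i + 1 + real (A ! j) \<le>
        real (A ! i) + (lfrac A i j + rfrac A i j)"
    proof (cases "A ! i = A ! j + 2")
      case True
      then show ?thesis using neg by auto
    next
      case False
      then have "real (A ! j) + 3 \<le> real (A ! i)" using ge by linarith
      then show ?thesis
        using lfrac_bounds01[OF pos, of i j] rfrac_bounds01[OF pos, of i j]
          lfrac_bounds01[OF pos, of j i] rfrac_bounds01[OF pos, of j i] by linarith
    qed
    then have "crev A \<le> crev (transfer A i j)"
      using crev_le_transfer[OF pos neq] ij by blast
    moreover have "transfer A i j \<in> M n S"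
      using A ij ge neq transfer_pos[OF pos neq] Sphi_transfer[OF neq] by (simp add: M_def)
    ultimately have "sq A \<le> sq (transfer A i j)" using least A by fastforce
    then show False using sum_squares_transfer[OF neq ij(1,2) ge] by (simp add: sq_def)
  qed
  with A that show ?thesis by blast
qed

context
  fixes A :: "nat list"
  assumes pos: "\<forall>x\<in>set A. 0 < x" and bal: "balanced A"
begin

lemma balanced_range:
  assumes "i < length A" "j < length A" "even i = even j"
  shows "A ! i \<le> A ! j + 2"
  using bal assms unfolding balanced_def by (metis nle_le)

lemma balanced_less:
  assumes "i < length A" "j < length A" "even i = even j" "A ! j + 2 \<le> A ! i"
  shows "1 + (lfrac A i j + rfrac A i j) < lfrac A j i + rfrac A j i"
  using bal assms unfolding balanced_def by blast

text \<open>At distance two the common fraction cancels, and one of the remaining two would have to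
  exceed 1.\<close>

lemma balanced_not_two_apart:
  assumes "i < length A" "j < length A" "even i = even j" "A ! j + 2 \<le> A ! i"
  shows "i \<noteq> j + 2" "j \<noteq> i + 2"
  using balanced_less[OF assms] lfrac_rfrac_two_apart[OF pos, of i]
    lfrac_rfrac_two_apart[OF pos, of j] assms
    lfrac_bounds01[OF pos, of i j] rfrac_bounds01[OF pos, of i j]
    lfrac_bounds01[OF pos, of j i] rfrac_bounds01[OF pos, of j i]
  by auto

text \<open>Two neighbours of \<open>j\<close> that are both at least 2 would give at most 1/2 + 1/2
  on the right of \<open>balanced_less\<close>, so one is 1 and the other class is at most 3. Then
  each fraction at \<open>i\<close> is at least 1/4, the right side exceeds 3/2, and both neighbours
  are 1.\<close>

lemma balanced_neighbours:
  assumes i: "2 \<le> i" "i + 2 < length A" and j: "2 \<le> j" "j + 2 < length A"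
    and par: "even i = even j" and ge: "A ! j + 2 \<le> A ! i"
  shows "A ! (j - 1) = 1" "A ! (j + 1) = 1"
    and "\<And>k. k < length A \<Longrightarrow> even k \<noteq> even i \<Longrightarrow> A ! k \<le> 3"
proof -
  have len: "i < length A" "j < length A" using i j by auto
  have less: "1 + (lfrac A i j + rfrac A i j) < lfrac A j i + rfrac A j i"
    using balanced_less[OF len(1,2) par ge] .
  have ne: "i \<noteq> j - 1" "i \<noteq> j + 1" "j \<noteq> i - 1" "j \<noteq> i + 1" using par i j by auto
  note up = lfrac_bounds(1)[OF pos j(1) len(2) ne(1)] rfrac_bounds(1)[OF pos j(2) ne(2)]
  note lo = lfrac_bounds(2)[OF pos i(1) len(1) ne(3)] rfrac_bounds(2)[OF pos i(2) ne(4)]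
  have p: "0 < A ! (j - 1)" "0 < A ! (j + 1)" using nth_pos[OF pos] j by auto
  have half: "1 / real x \<le> 1 / 2" if "x \<noteq> 1" "0 < x" for x :: nat
    using that by (simp add: frac_le)
  have "A ! (j - 1) = 1 \<or> A ! (j + 1) = 1"
    using less up half[of "A ! (j - 1)"] half[of "A ! (j + 1)"] p
      lfrac_bounds01[OF pos, of i j] rfrac_bounds01[OF pos, of i j] by linarith
  then obtain q where q: "q < length A" "even q \<noteq> even i" "A ! q = 1"
  proof
    assume "A ! (j - 1) = 1"
    then show ?thesis using that[of "j - 1"] par j by simp
  next
    assume "A ! (j + 1) = 1"
    then show ?thesis using that[of "j + 1"] par j by simp
  qed
  show le3: "A ! k \<le> 3" if "k < length A" "even k \<noteq> even i" for k
    using balanced_range[of k q] that q by auto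
  have quarter: "1 / 4 \<le> 1 / (real x + 1)" if "x \<le> 3" for x :: nat
    using that by (intro frac_le) auto
  have "A ! (i - 1) \<le> 3" "A ! (i + 1) \<le> 3" using i by (auto intro!: le3)
  then have "1 / 2 \<le> lfrac A i j + rfrac A i j"
    using lo quarter[of "A ! (i - 1)"] quarter[of "A ! (i + 1)"] by linarith
  then show "A ! (j - 1) = 1" "A ! (j + 1) = 1"
    using less up half[of "A ! (j - 1)"] half[of "A ! (j + 1)"] p
      lfrac_bounds01[OF pos, of j i] rfrac_bounds01[OF pos, of j i] by linarith+
qed

text \<open>The margin is 3 so that the neighbours of \<open>i\<close> and \<open>j\<close> still
  have the margin 2 needed in \<open>balanced_neighbours\<close>.\<close>

lemma balanced_no_inner_gap:
  assumes i: "3 \<le> i" "i + 3 < length A" and j: "3 \<le> j" "j + 3 < length A"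
    and par: "even i = even j" and ge: "A ! j + 2 \<le> A ! i"
  shows False
proof -
  have len: "i < length A" "j < length A" "i - 2 < length A" "j - 2 < length A" using i j by auto
  have i2: "2 \<le> i" "i + 2 < length A" and j2: "2 \<le> j" "j + 2 < length A" using i j by auto
  note nb = balanced_neighbours[OF i2 j2 par ge]
  have not3: "A ! p \<noteq> 3" if p: "p = i - 1 \<or> p = i + 1" for p
  proof
    assume p3: "A ! p = 3"
    have pin: "2 \<le> p" "p + 2 < length A" "even p \<noteq> even i" using p i by auto
    \<comment> \<open>The entries 3 at \<open>p\<close> and 1 at \<open>j + 1\<close> form a gap in
      the other class, so \<open>j\<close>, a neighbour of \<open>j + 1\<close>, also carries
      1.\<close>
    have "A ! (j + 1 - 1) = 1"
      using balanced_neighbours(1)[OF pin(1,2), of "j + 1"] pin(3) par p3 nb(2) j by simp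
    then have j1: "A ! j = 1" by simp
    then have Ai: "3 \<le> A ! i" using ge by simp
    \<comment> \<open>Any such 1 forms a gap with \<open>i\<close> or with \<open>p\<close>,
      according to its parity. Stepping from \<open>j\<close> to \<open>i\<close> then yields
      \<open>A ! i = 1\<close>.\<close>
    have spread: "A ! (k - 1) = 1 \<and> A ! (k + 1) = 1"
      if "2 \<le> k" "k + 2 < length A" "A ! k = 1" for k
    proof (cases "even k = even i")
      case True
      then show ?thesis using balanced_neighbours(1,2)[OF i2 that(1,2)] that Ai by auto
    next
      case False
      then show ?thesis
        using balanced_neighbours(1,2)[OF pin(1,2) that(1,2)] that p3 pin(3) by auto
    qed
    have "A ! (j + d) = 1" if "j + d \<le> i" for d
      using that
    proof (induction d)
      case (Suc d)
      then show ?case using spread[of "j + d"] i j by simp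
    qed (simp add: j1)
    moreover have "A ! (j - d) = 1" if "i \<le> j - d" for d
      using that
    proof (induction d)
      case (Suc d)
      then show ?case using spread[of "j - d"] i j by simp
    qed (simp add: j1)
    ultimately have "A ! i = 1"
      by (metis diff_diff_cancel le_add_diff_inverse le_refl nle_le)
    then show False using Ai by simp
  qed
  have "i - 1 < length A" using len by simp
  then have flank: "A ! (i - 1) \<le> 2" "A ! (i + 1) \<le> 2"
    using nb(3)[of "i - 1"] nb(3)[of "i + 1"] not3[of "i - 1"] not3[of "i + 1"] i len by auto
  define c where "c = real (A ! j)"
  have c: "1 \<le> c" using nth_pos[OF pos len(2)] by (simp add: c_def)
  have less: "1 + (lfrac A i j + rfrac A i j) < lfrac A j i + rfrac A j i"
    using balanced_less[OF len(1,2) par ge] .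
  have ne: "i \<noteq> j - 1" "i \<noteq> j + 1" "j \<noteq> i - 1" "j \<noteq> i + 1" using par i j by auto
  have ne2: "i \<noteq> j - 2" "i \<noteq> j + 2"
    using balanced_not_two_apart[OF len(1,2) par ge] j by auto
  have lower: "1 / (2 + 1 / c) \<le> 1 / (real x + 1 / real y)"
    if "x \<le> 2" "0 < x" "A ! j \<le> y" for x y :: nat
    using that c by (intro frac_le add_mono add_pos_nonneg) (auto simp: c_def)
  have upper: "1 / (1 + 1 / (real y + 1)) \<le> 1 / (1 + 1 / (c + 3))"
    if "y \<le> A ! j + 2" for y :: nat
  proof -
    have "real y + 1 \<le> c + 3" using that by (simp add: c_def)
    then have "1 / (c + 3) \<le> 1 / (real y + 1)" by (intro frac_le) auto
    then show ?thesis using c by (intro frac_le) (auto intro: add_pos_nonneg)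
  qed
  \<comment> \<open>Entries of the class of \<open>i\<close> are at least \<open>A ! i - 2\<close>,
    hence at least \<open>A ! j\<close>.\<close>
  have "A ! j \<le> A ! (i - 2)" "A ! j \<le> A ! (i + 2)"
    using balanced_range[of i "i - 2"] balanced_range[of i "i + 2"] i len ge by auto
  then have "2 / (2 + 1 / c) \<le> lfrac A i j + rfrac A i j"
    using lfrac_bounds(3)[OF pos i2(1) len(1) ne(3)] rfrac_bounds(3)[OF pos i2(2) ne(4)]
      lower[OF flank(1), of "A ! (i - 2)"] lower[OF flank(2), of "A ! (i + 2)"]
      nth_pos[OF pos, of "i - 1"] nth_pos[OF pos, of "i + 1"] i by simp
  moreover have "A ! (j - 2) \<le> A ! j + 2" "A ! (j + 2) \<le> A ! j + 2"
    using balanced_range[of "j - 2" j] balanced_range[of "j + 2" j] j len by auto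
  then have "lfrac A j i + rfrac A j i \<le> 2 / (1 + 1 / (c + 3))"
    using lfrac_bounds(4)[OF pos j2(1) len(2) ne(1) ne2(1)]
      rfrac_bounds(4)[OF pos j2(2) ne(2) ne2(2) len(1)] nb(1,2)
      upper[of "A ! (j - 2)"] upper[of "A ! (j + 2)"] by simp
  moreover have "2 / (1 + 1 / (c + 3)) \<le> 1 + 2 / (2 + 1 / c)"
  proof -
    have "2 / (1 + 1 / (c + 3)) = 2 - 2 / (c + 4)" "2 / (2 + 1 / c) = 1 - 1 / (2 * c + 1)"
      using c by (simp_all add: field_simps)
    moreover have "1 / (2 * c + 1) \<le> 2 / (c + 4)"
      using c by (simp add: field_simps)
    ultimately show ?thesis by linarith
  qed
  ultimately show False using less by linarith
qed

end

section \<open>Repairing the entries near the ends\<close>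

text \<open>A transfer from an entry \<open>c + 2\<close> to an entry \<open>c\<close> makes both
  \<open>c + 1\<close>, removing one of each extreme at the cost of a factor 2. After at most
  \<open>N\<close> of them one extreme is gone. The other class stays fixed, so the two classes can
  be treated in turn.\<close>

lemma narrow_class:
  assumes "\<forall>x\<in>set A. 0 < x" and c: "0 < c"
    and "\<And>k. k < length A \<Longrightarrow> even k = e \<Longrightarrow> A ! k \<in> {c, c + 1, c + 2}"
    and "card {k. k < length A \<and> even k = e \<and> A ! k = c} \<le> N \<or>
      card {k. k < length A \<and> even k = e \<and> A ! k = c + 2} \<le> N"
  shows "\<exists>B. length B = length A \<and> (\<forall>x\<in>set B. 0 < x) \<and> Sphi B = Sphi A \<and>
    crev A \<le> 2 ^ N * crev B \<and> (\<forall>k<length A. even k \<noteq> e \<longrightarrow> B ! k = A ! k) \<and>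
    (\<exists>b>0. \<forall>k<length A. even k = e \<longrightarrow> B ! k \<in> {b, b + 1})"
  using assms(1,3,4)
proof (induction N arbitrary: A)
  case (0 A)
  define lo hi where "lo = {k. k < length A \<and> even k = e \<and> A ! k = c}"
    and "hi = {k. k < length A \<and> even k = e \<and> A ! k = c + 2}"
  have "lo = {} \<or> hi = {}"
    using 0(3) by (auto simp: lo_def hi_def)
  then have "\<exists>b>0. \<forall>k<length A. even k = e \<longrightarrow> A ! k \<in> {b, b + 1}"
  proof
    assume "lo = {}"
    then show ?thesis using 0(2) by (intro exI[of _ "c + 1"]) (fastforce simp: lo_def)
  next
    assume "hi = {}"
    then show ?thesis using 0(2) c by (intro exI[of _ c]) (fastforce simp: hi_def)
  qed
  then show ?case using 0(1) by (intro exI[of _ A]) simp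
next
  case (Suc N A)
  define lo hi where "lo A = {k. k < length A \<and> even k = e \<and> A ! k = c}"
    and "hi A = {k. k < length A \<and> even k = e \<and> A ! k = c + 2}" for A
  show ?case
  proof (cases "lo A = {} \<or> hi A = {}")
    case True
    then have "card (lo A) \<le> N \<or> card (hi A) \<le> N" by auto
    then obtain B where "length B = length A" "\<forall>x\<in>set B. 0 < x" "Sphi B = Sphi A"
      "crev A \<le> 2 ^ N * crev B" "\<forall>k<length A. even k \<noteq> e \<longrightarrow> B ! k = A ! k"
      "\<exists>b>0. \<forall>k<length A. even k = e \<longrightarrow> B ! k \<in> {b, b + 1}"
      using Suc.IH[OF Suc.prems(1,2)] unfolding lo_def hi_def by blast
    then show ?thesis by (intro exI[of _ B]) simp
  next
    case False
    then obtain i j where i: "i \<in> hi A" and j: "j \<in> lo A" by blast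
    then have ij: "i \<noteq> j" "i < length A" "j < length A" "even i = e" "even j = e"
      "A ! i = c + 2" "A ! j = c" by (auto simp: lo_def hi_def)
    let ?T = "transfer A i j"
    note nth = nth_transfer[OF ij(1-3)]
    have "lo ?T = lo A - {j}" "hi ?T = hi A - {i}"
      using ij c by (auto simp: lo_def hi_def nth)
    then have "card (lo ?T) = card (lo A) - 1" "card (hi ?T) = card (hi A) - 1"
      using i j by (simp_all only: card_Diff_singleton)
    moreover have "card (lo A) \<le> Suc N \<or> card (hi A) \<le> Suc N"
      using Suc.prems(3) by (simp only: lo_def hi_def)
    ultimately have "card (lo ?T) \<le> N \<or> card (hi ?T) \<le> N" by linarith
    moreover have "?T ! k \<in> {c, c + 1, c + 2}" if "k < length ?T" "even k = e" for k
      using Suc.prems(2)[of k] that(1)[unfolded length_transfer] that(2) ij(6,7)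
      by (simp add: nth del: even_Suc)
    moreover have "\<forall>x\<in>set ?T. 0 < x" using transfer_pos[OF Suc.prems(1) ij(1-3)] ij by simp
    ultimately obtain B where B: "length B = length ?T" "\<forall>x\<in>set B. 0 < x" "Sphi B = Sphi ?T"
      "crev ?T \<le> 2 ^ N * crev B" "\<forall>k<length ?T. even k \<noteq> e \<longrightarrow> B ! k = ?T ! k"
      "\<exists>b>0. \<forall>k<length ?T. even k = e \<longrightarrow> B ! k \<in> {b, b + 1}"
      using Suc.IH[of ?T] unfolding lo_def hi_def by blast
    have "crev A \<le> 2 * crev ?T" using crev_le_twice_transfer[OF ij(1-3)] ij by simp
    also have "\<dots> \<le> 2 ^ Suc N * crev B" using B(4) by simp
    finally have "crev A \<le> 2 ^ Suc N * crev B" .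
    moreover have "Sphi ?T = Sphi A" using Sphi_transfer[OF ij(1-3)] ij by simp
    moreover have "\<forall>k<length A. even k \<noteq> e \<longrightarrow> ?T ! k = A ! k" using ij by (auto simp: nth)
    ultimately show ?thesis using B by (intro exI[of _ B]) simp
  qed
qed

lemma balanced_class:
  assumes pos: "\<forall>x\<in>set A. 0 < x" and bal: "balanced A"
  obtains c where "0 < c"
    "\<And>k. k < length A \<Longrightarrow> even k = e \<Longrightarrow> A ! k \<in> {c, c + 1, c + 2}"
    "card {k. k < length A \<and> even k = e \<and> A ! k = c} \<le> 6 \<or>
      card {k. k < length A \<and> even k = e \<and> A ! k = c + 2} \<le> 6"
proof (cases "\<exists>k<length A. even k = e")
  case False
  then have "{k. k < length A \<and> even k = e \<and> A ! k = 1} = {}" by blast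
  \<comment> \<open>The class is empty, so an arbitrary positive \<open>c\<close> serves.\<close>
  then show ?thesis using that[of 1] False by (metis card.empty le0 zero_less_one)
next
  case True
  then obtain k0 where "k0 < length A \<and> even k0 = e" by blast
  from ex_has_least_nat[of "\<lambda>k. k < length A \<and> even k = e", OF this, of "(!) A"]
  obtain m where m: "m < length A" "even m = e"
    and least: "\<And>k. k < length A \<Longrightarrow> even k = e \<Longrightarrow> A ! m \<le> A ! k" by blast
  \<comment> \<open>The three positions at each end, outside the reach of
    \<open>balanced_no_inner_gap\<close>; in short lists some coincide.\<close>
  define E where "E = {0, 1, 2, length A - 1, length A - 2, length A - 3}"
  have E: "k \<in> E" if "k < length A" "\<not> (3 \<le> k \<and> k + 3 < length A)" for k
    using that by (auto simp: E_def)
  have "card E \<le> 6"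
    using card_length[of "[0, 1, 2, length A - 1, length A - 2, length A - 3]"]
    by (simp add: E_def)
  have finE: "finite E" by (simp add: E_def)
  have cardE: "card X \<le> 6" if "X \<subseteq> E" for X
    using card_mono[OF finE that] \<open>card E \<le> 6\<close> by simp
  let ?lo = "{k. k < length A \<and> even k = e \<and> A ! k = A ! m}"
  let ?hi = "{k. k < length A \<and> even k = e \<and> A ! k = A ! m + 2}"
  have "?lo \<subseteq> E \<or> ?hi \<subseteq> E"
  proof (rule ccontr)
    assume "\<not> ?thesis"
    then obtain i j where "i \<in> ?hi - E" "j \<in> ?lo - E" by blast
    then show False using balanced_no_inner_gap[OF pos bal, of i j] E[of i] E[of j] by auto
  qed
  then have "card ?lo \<le> 6 \<or> card ?hi \<le> 6" using cardE by blast
  moreover have "A ! k \<in> {A ! m, A ! m + 1, A ! m + 2}" if "k < length A" "even k = e" for k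
    using least[OF that] balanced_range[OF pos bal, of k m] that m by auto
  ultimately show ?thesis using that[of "A ! m"] nth_pos[OF pos m(1)] by blast
qed

section \<open>Comparison of the two maxima\<close>

lemma crev_le_M4:
  assumes "B \<in> M n S"
  shows "\<exists>C\<in>M4 n S. crev B \<le> 4096 * crev C"
proof -
  obtain A where A: "A \<in> M n S" "crev B \<le> crev A" "balanced A"
    using exists_balanced[OF assms] .
  have len: "length A = n" and pos: "\<forall>x\<in>set A. 0 < x" and S: "Sphi A = S"
    using A by (auto simp: M_def)
  obtain c where c: "0 < c"
    "\<And>k. k < length A \<Longrightarrow> even k = True \<Longrightarrow> A ! k \<in> {c, c + 1, c + 2}"
    "card {k. k < length A \<and> even k = True \<and> A ! k = c} \<le> 6 \<or>
      card {k. k < length A \<and> even k = True \<and> A ! k = c + 2} \<le> 6"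
    using balanced_class[OF pos A(3), of True] by blast
  obtain d where d: "0 < d"
    "\<And>k. k < length A \<Longrightarrow> even k = False \<Longrightarrow> A ! k \<in> {d, d + 1, d + 2}"
    "card {k. k < length A \<and> even k = False \<and> A ! k = d} \<le> 6 \<or>
      card {k. k < length A \<and> even k = False \<and> A ! k = d + 2} \<le> 6"
    using balanced_class[OF pos A(3), of False] by blast
  obtain A' a where A': "length A' = n" "\<forall>x\<in>set A'. 0 < x" "Sphi A' = S"
    "crev A \<le> 64 * crev A'" "\<And>k. k < n \<Longrightarrow> odd k \<Longrightarrow> A' ! k = A ! k"
    "0 < a" "\<And>k. k < n \<Longrightarrow> even k \<Longrightarrow> A' ! k \<in> {a, a + 1}"
    using narrow_class[OF pos c] by (auto simp: len S)
  \<comment> \<open>The first repair left the odd indices alone, so the hypotheses for them carry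
    over to \<open>A'\<close>.\<close>
  have d': "A' ! k \<in> {d, d + 1, d + 2}" if "k < length A'" "even k = False" for k
    using that A' d(2) len by simp
  have "{k. k < length A' \<and> even k = False \<and> A' ! k = x} =
      {k. k < length A \<and> even k = False \<and> A ! k = x}" for x
    using A' len by auto
  then have "card {k. k < length A' \<and> even k = False \<and> A' ! k = d} \<le> 6 \<or>
      card {k. k < length A' \<and> even k = False \<and> A' ! k = d + 2} \<le> 6"
    using d(3) by simp
  from narrow_class[OF A'(2) d(1) d' this]
  obtain C b where C: "length C = n" "\<forall>x\<in>set C. 0 < x" "Sphi C = S"
    "crev A' \<le> 64 * crev C" "\<And>k. k < n \<Longrightarrow> even k \<Longrightarrow> C ! k = A' ! k"
    "0 < b" "\<And>k. k < n \<Longrightarrow> odd k \<Longrightarrow> C ! k \<in> {b, b + 1}"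
    by (auto simp: A')
  have "C \<in> M4 n S"
  proof -
    have "0 < a \<and> 0 < b \<and> (\<forall>k<length C.
        (even k \<longrightarrow> C ! k \<in> {a, a + 1}) \<and> (odd k \<longrightarrow> C ! k \<in> {b, b + 1}))"
      using C A'(6,7) by simp
    then show ?thesis using C(1-3) unfolding M4_def M_def by blast
  qed
  \<comment> \<open>4096 = 64 * 64: up to six transfers in each class, each costing a factor
    2.\<close>
  moreover have "crev B \<le> 4096 * crev C" using A(2) A'(4) C(4) by linarith
  ultimately show ?thesis by blast
qed

text \<open>All weights are at least 1, so the entries are bounded by \<open>S\<close>; this makes
  \<open>Max\<close> meaningful.\<close>

lemma finite_M: "finite (M n S)"
proof -
  have "M n S \<subseteq> {A. set A \<subseteq> {..S} \<and> length A = n}"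
  proof
    fix A assume A: "A \<in> M n S"
    have "A ! i \<le> S" if "i < length A" for i
    proof -
      have "A ! i * 1 \<le> A ! i * (if even (i + 1) then 2 else 1)" by simp
      also have "\<dots> \<le> Sphi A"
        unfolding Sphi_def
        by (rule member_le_sum[of i "{..<length A}"
              "\<lambda>k. A ! k * (if even (k + 1) then 2 else 1)"]) (use that in auto)
      finally show ?thesis using A by (simp add: M_def)
    qed
    then show "A \<in> {A. set A \<subseteq> {..S} \<and> length A = n}"
      using A by (auto simp: M_def in_set_conv_nth)
  qed
  then show ?thesis by (rule finite_subset) (simp add: finite_lists_length_eq)
qed

theorem theorem1:
  "\<exists>c1 c2 :: real. 0 < c1 \<and> 0 < c2 \<and>
     (\<forall>n S. 0 < n \<longrightarrow> 0 < S \<longrightarrow> M n S \<noteq> {} \<longrightarrow>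
        M4 n S \<noteq> {} \<and>
        c1 \<le> real (maxM n S) / real (maxM4 n S) \<and>
        real (maxM n S) / real (maxM4 n S) \<le> c2)"
proof (rule exI[of _ 1], rule exI[of _ 4096], intro conjI allI impI)
  fix n S :: nat
  assume ne: "M n S \<noteq> {}"
  \<comment> \<open>This inclusion yields the lower constant 1; the upper constant is the one in
    \<open>crev_le_M4\<close>.\<close>
  have sub: "M4 n S \<subseteq> M n S" by (auto simp: M4_def)
  have fin: "finite (M n S)" "finite (M4 n S)"
    using finite_M finite_subset[OF sub] by auto
  show ne4: "M4 n S \<noteq> {}" using ne crev_le_M4 by blast
  have cont: "continuant A = crev A" for A
    by (simp add: continuant_def crev_rev)
  have "maxM n S \<in> continuant ` M n S" unfolding maxM_def using fin ne by (intro Max_in) auto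
  then obtain B where B: "B \<in> M n S" "maxM n S = crev B" by (auto simp: cont)
  then obtain C where C: "C \<in> M4 n S" "crev B \<le> 4096 * crev C" using crev_le_M4 by blast
  have C4: "crev C \<le> maxM4 n S"
    unfolding maxM4_def cont[symmetric] using C fin by (intro Max_ge) auto
  have "0 < crev C" using C(1) sub by (intro crev_pos) (auto simp: M_def)
  then have pos: "0 < maxM4 n S" using C4 by simp
  have "maxM4 n S \<le> maxM n S"
    unfolding maxM_def maxM4_def using fin ne4 sub by (intro Max_mono) auto
  then show "1 \<le> real (maxM n S) / real (maxM4 n S)" using pos by simp
  have "maxM n S \<le> 4096 * maxM4 n S" using B C C4 by simp
  then have "real (maxM n S) \<le> 4096 * real (maxM4 n S)" by linarith
  then show "real (maxM n S) / real (maxM4 n S) \<le> 4096" using pos by (simp add: divide_le_eq)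
qed simp_all

end
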